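(* The elements $A^iB^jC^k\Omega^\ell\alpha^r\beta^s\gamma^t$ with $i,j,k,\ell,r,s,t\geq 0$ and $ijk=0$ form a basis for the $\mathbb F$-vector space $\Delta$.
   Context: Let $\mathbb F$ be a field and fix a nonzero $q\in\mathbb F$ with $q^4\neq 1$. The universal Askey--Wilson algebra $\Delta$ is the associative $\mathbb F$-algebra with 1 with generators $A,B,C$ subject to the relations that each of $A+\frac{qBC-q^{-1}CB}{q^2-q^{-2}}$, $B+\frac{qCA-q^{-1}AC}{q^2-q^{-2}}$, $C+\frac{qAB-q^{-1}BA}{q^2-q^{-2}}$ is central; $\alpha,\beta,\gamma$ denote these three central elements (in order) each multiplied by $q+q^{-1}$. Let $\Omega = qABC+q^2A^2+q^{-2}B^2+q^2C^2-qA\alpha-q^{-1}B\beta-qC\gamma$. *)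

theory Defs
  imports Main
begin

text \<open>Free associative algebra on three generators A, B, C over a field:
  elements are functions from words to coefficients (only finitely supported
  ones are considered); multiplication is concatenation convolution.\<close>

datatype gen = GA | GB | GC

type_synonym 'a fa = "gen list \<Rightarrow> 'a"

definition fa_zero :: "'a::field fa" where "fa_zero = (\<lambda>w. 0)"
definition fa_one :: "'a::field fa" where "fa_one = (\<lambda>w. if w = [] then 1 else 0)"
definition fa_word :: "gen list \<Rightarrow> 'a::field fa" where
  "fa_word u = (\<lambda>w. if w = u then 1 else 0)"
definition fa_gen :: "gen \<Rightarrow> 'a::field fa" where "fa_gen x = fa_word [x]"
definition fa_add :: "'a::field fa \<Rightarrow> 'a fa \<Rightarrow> 'a fa" where
  "fa_add f g = (\<lambda>w. f w + g w)"
definition fa_diff :: "'a::field fa \<Rightarrow> 'a fa \<Rightarrow> 'a fa" where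
  "fa_diff f g = (\<lambda>w. f w - g w)"
definition fa_smult :: "'a::field \<Rightarrow> 'a fa \<Rightarrow> 'a fa" where
  "fa_smult c f = (\<lambda>w. c * f w)"
definition fa_mult :: "'a::field fa \<Rightarrow> 'a fa \<Rightarrow> 'a fa" where
  "fa_mult f g = (\<lambda>w. \<Sum>i\<le>length w. f (take i w) * g (drop i w))"

primrec fa_pow :: "'a::field fa \<Rightarrow> nat \<Rightarrow> 'a fa" where
  "fa_pow f 0 = fa_one"
| "fa_pow f (Suc n) = fa_mult f (fa_pow f n)"

definition fa_sum :: "'b set \<Rightarrow> ('b \<Rightarrow> 'a::field fa) \<Rightarrow> 'a fa" where
  "fa_sum S F = (\<lambda>w. \<Sum>x\<in>S. F x w)"

definition fa_finsupp :: "'a::field fa \<Rightarrow> bool" where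
  "fa_finsupp f \<longleftrightarrow> finite {w. f w \<noteq> 0}"

definition fa_comm :: "'a::field fa \<Rightarrow> 'a fa \<Rightarrow> 'a fa" where
  "fa_comm f g = fa_diff (fa_mult f g) (fa_mult g f)"

definition aw_x :: "'a::field \<Rightarrow> gen \<Rightarrow> gen \<Rightarrow> gen \<Rightarrow> 'a fa" where
  "aw_x q a b c = fa_add (fa_gen a)
     (fa_smult (inverse (q^2 - inverse q ^ 2))
        (fa_diff (fa_smult q (fa_mult (fa_gen b) (fa_gen c)))
                 (fa_smult (inverse q) (fa_mult (fa_gen c) (fa_gen b)))))"

definition aw_xA :: "'a::field \<Rightarrow> 'a fa" where "aw_xA q = aw_x q GA GB GC"
definition aw_xB :: "'a::field \<Rightarrow> 'a fa" where "aw_xB q = aw_x q GB GC GA"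
definition aw_xC :: "'a::field \<Rightarrow> 'a fa" where "aw_xC q = aw_x q GC GA GB"

text \<open>Defining relations of Delta: the three elements above commute with
  every generator (i.e. are central).\<close>
definition aw_relators :: "'a::field \<Rightarrow> 'a fa set" where
  "aw_relators q = {fa_comm x (fa_gen g) | x g. x \<in> {aw_xA q, aw_xB q, aw_xC q}}"

text \<open>The two-sided ideal of the free algebra generated by the relators
  (= linear span of all u r v, u v words, r a relator).\<close>
inductive_set aw_ideal :: "'a::field \<Rightarrow> 'a fa set" for q :: 'a where
  rel: "r \<in> aw_relators q \<Longrightarrow> r \<in> aw_ideal q"
| zero: "fa_zero \<in> aw_ideal q"
| add: "x \<in> aw_ideal q \<Longrightarrow> y \<in> aw_ideal q \<Longrightarrow> fa_add x y \<in> aw_ideal q"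
| smult: "x \<in> aw_ideal q \<Longrightarrow> fa_smult c x \<in> aw_ideal q"
| mult: "x \<in> aw_ideal q \<Longrightarrow> fa_mult (fa_word u) (fa_mult x (fa_word v)) \<in> aw_ideal q"

definition aw_A :: "'a::field fa" where "aw_A = fa_gen GA"
definition aw_B :: "'a::field fa" where "aw_B = fa_gen GB"
definition aw_C :: "'a::field fa" where "aw_C = fa_gen GC"

definition aw_alpha :: "'a::field \<Rightarrow> 'a fa" where
  "aw_alpha q = fa_smult (q + inverse q) (aw_xA q)"
definition aw_beta :: "'a::field \<Rightarrow> 'a fa" where
  "aw_beta q = fa_smult (q + inverse q) (aw_xB q)"
definition aw_gamma :: "'a::field \<Rightarrow> 'a fa" where
  "aw_gamma q = fa_smult (q + inverse q) (aw_xC q)"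

definition aw_Omega :: "'a::field \<Rightarrow> 'a fa" where
  "aw_Omega q =
     fa_diff (fa_diff (fa_diff
       (fa_add (fa_add (fa_add
          (fa_smult q (fa_mult aw_A (fa_mult aw_B aw_C)))
          (fa_smult (q^2) (fa_mult aw_A aw_A)))
          (fa_smult (inverse q ^ 2) (fa_mult aw_B aw_B)))
          (fa_smult (q^2) (fa_mult aw_C aw_C)))
       (fa_smult q (fa_mult aw_A (aw_alpha q))))
       (fa_smult (inverse q) (fa_mult aw_B (aw_beta q))))
       (fa_smult q (fa_mult aw_C (aw_gamma q)))"

type_synonym idx7 = "nat \<times> nat \<times> nat \<times> nat \<times> nat \<times> nat \<times> nat"

definition aw_index :: "idx7 set" where
  "aw_index = {(i,j,k,l,r,s,t). i * j * k = 0}"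

definition aw_mono :: "'a::field \<Rightarrow> idx7 \<Rightarrow> 'a fa" where
  "aw_mono q = (\<lambda>(i,j,k,l,r,s,t).
     fa_mult (fa_pow aw_A i) (fa_mult (fa_pow aw_B j) (fa_mult (fa_pow aw_C k)
       (fa_mult (fa_pow (aw_Omega q) l) (fa_mult (fa_pow (aw_alpha q) r)
         (fa_mult (fa_pow (aw_beta q) s) (fa_pow (aw_gamma q) t)))))))"

end

theory Submission
  imports Defs "HOL-Library.Poly_Mapping" "HOL-Computational_Algebra.Polynomial"
begin

text \<open>
  Solving the definitions of \<open>\<alpha>, \<beta>, \<gamma>\<close> for \<open>BA\<close>, \<open>CB\<close>, \<open>CA\<close> gives a rewriting system over
  \<open>F[\<alpha>,\<beta>,\<gamma>]\<close> whose normal forms are the words \<open>A\<^sup>i B\<^sup>j C\<^sup>k\<close>. Its only overlap \<open>CBA\<close> resolves, so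
  the normal form is well defined; its linear extension vanishes on the ideal and shows that the
  \<open>A\<^sup>i B\<^sup>j C\<^sup>k \<alpha>\<^sup>r \<beta>\<^sup>s \<gamma>\<^sup>t\<close> are independent. Count only the letters \<open>A, B, C\<close>, so that \<open>\<alpha>, \<beta>, \<gamma>\<close>
  have degree 0. Then reordering a word changes it by a nonzero factor and terms of lower degree,
  and \<open>\<Omega>\<close> has leading term \<open>q ABC\<close>, so \<open>A\<^sup>i B\<^sup>j C\<^sup>k \<Omega>\<^sup>l\<close> has leading term a nonzero multiple of
  \<open>A\<^bsup>i+l\<^esup> B\<^bsup>j+l\<^esup> C\<^bsup>k+l\<^esup>\<close>. For \<open>ijk = 0\<close> the map \<open>(i,j,k,l) \<mapsto> (i+l,j+l,k+l)\<close> is a bijection onto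
  all exponent triples, so the transition to the previous basis is triangular.
\<close>

section \<open>Rewriting words to normal form\<close>

fun gen_rank :: "gen \<Rightarrow> nat" where
  "gen_rank GA = 0" | "gen_rank GB = 1" | "gen_rank GC = 2"

text \<open>Length is compared first because the rules also produce shorter words. At equal length,
  swapping a descent lowers the first letter that changes.\<close>

definition word_rel :: "(gen list \<times> gen list) set" where
  "word_rel = lenlex (measure gen_rank)"

lemma wf_word_rel: "wf word_rel"
  by (auto simp: word_rel_def)

lemma word_rel_shorter: "length v < length w \<Longrightarrow> (v, w) \<in> word_rel"
  by (simp add: word_rel_def lenlex_conv)

lemma word_rel_swap:
  "gen_rank h < gen_rank g \<Longrightarrow> (u @ h # g # v, u @ g # h # v) \<in> word_rel"
  unfolding word_rel_def by (subst lenlex_append2) (auto simp: irrefl_def Cons_lenlex_iff)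

definition is_redex :: "gen list \<Rightarrow> gen list \<times> gen \<times> gen \<times> gen list \<Rightarrow> bool" where
  "is_redex w = (\<lambda>(u, g, h, v). w = u @ g # h # v \<and> gen_rank h < gen_rank g)"

definition reducible :: "gen list \<Rightarrow> bool" where
  "reducible w \<longleftrightarrow> (\<exists>d. is_redex w d)"

definition some_redex :: "gen list \<Rightarrow> gen list \<times> gen \<times> gen \<times> gen list" where
  "some_redex w = (SOME d. is_redex w d)"

lemma some_redex: "reducible w \<Longrightarrow> is_redex w (some_redex w)"
  unfolding reducible_def some_redex_def by (rule someI_ex)

text \<open>The third generator, which the rule for the descent \<open>g h\<close> produces as its
  linear term. The catch-all equation serves the descent \<open>GC GA\<close>.\<close>

fun other_gen :: "gen \<Rightarrow> gen \<Rightarrow> gen" where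
  "other_gen GB GA = GC" | "other_gen GC GB = GA" | "other_gen _ _ = GB"

text \<open>The rewriting system \<open>BA \<rightarrow> Q AB + a C - z\<close>, \<open>CB \<rightarrow> Q BC + a A - x\<close>,
  \<open>CA \<rightarrow> Q\<inverse> (AC - a B + y)\<close>.\<close>

locale aw_rewriting =
  fixes Q Q' a x y z :: "'r::comm_ring_1"
  assumes QQ': "Q * Q' = 1"
begin

definition swap_coeff :: "gen \<Rightarrow> gen \<Rightarrow> 'r" where
  "swap_coeff g h = (if g = GC \<and> h = GA then Q' else Q)"

definition gen_coeff :: "gen \<Rightarrow> gen \<Rightarrow> 'r" where
  "gen_coeff g h = (if g = GC \<and> h = GA then - (Q' * a) else a)"

definition const_coeff :: "gen \<Rightarrow> gen \<Rightarrow> 'r" where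
  "const_coeff g h = (if g = GC then if h = GA then Q' * y else - x else - z)"

text \<open>\<open>nf w s\<close> is the coefficient of \<open>s\<close> in the normal form of
  \<open>w\<close>. Reducing one arbitrarily chosen redex makes this a function at once;
  independence of the choice is proved afterwards.\<close>

function nf :: "gen list \<Rightarrow> gen list \<Rightarrow> 'r" where
  "nf w s = (if reducible w then
       (case some_redex w of (u, g, h, v) \<Rightarrow>
         swap_coeff g h * nf (u @ h # g # v) s
         + gen_coeff g h * nf (u @ other_gen g h # v) s
         + const_coeff g h * nf (u @ v) s)
     else if s = w then 1 else 0)"
  by pat_completeness auto
termination
proof (relation "inv_image word_rel fst")
  show "wf (inv_image word_rel (fst :: gen list \<times> gen list \<Rightarrow> _))"
    by (simp add: wf_word_rel)
qed (use some_redex in \<open>force simp: is_redex_def intro: word_rel_swap word_rel_shorter\<close>)+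

declare nf.simps [simp del]

section \<open>Confluence of the rewriting system\<close>

definition reduct :: "gen list \<Rightarrow> gen \<Rightarrow> gen \<Rightarrow> gen list \<Rightarrow> gen list \<Rightarrow> 'r" where
  "reduct u g h v s = swap_coeff g h * nf (u @ h # g # v) s
         + gen_coeff g h * nf (u @ other_gen g h # v) s
         + const_coeff g h * nf (u @ v) s"

lemma nf_irreducible: "\<not> reducible w \<Longrightarrow> nf w s = (if s = w then 1 else 0)"
  by (simp add: nf.simps)

lemma nf_some_redex:
  assumes "is_redex w d"
  obtains u g h v where "is_redex w (u, g, h, v)" "\<And>s. nf w s = reduct u g h v s"
proof -
  from assms have r: "reducible w" unfolding reducible_def ..
  obtain u g h v where d: "some_redex w = (u, g, h, v)" by (metis prod_cases4)
  show thesis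
    by (rule that[of u g h v])
      (use some_redex[OF r] d r in \<open>simp_all add: reduct_def nf.simps[of w]\<close>)
qed

text \<open>Rules acting at disjoint places commute: each reduct can be reduced further at the other
  place, and both orders yield the same double sum of nine terms.\<close>

lemma disjoint_reducts_agree:
  assumes IH: "\<And>w' u' g' h' v'. (w', u1 @ g1 # h1 # m @ g # h # v) \<in> word_rel \<Longrightarrow>
      is_redex w' (u', g', h', v') \<Longrightarrow> nf w' s = reduct u' g' h' v' s"
    and r1: "gen_rank h1 < gen_rank g1" and r: "gen_rank h < gen_rank g"
  shows "reduct u1 g1 h1 (m @ g # h # v) s = reduct (u1 @ g1 # h1 # m) g h v s"
proof -
  \<comment> \<open>Replacing the left redex by any \<open>X\<close> leaves the right redex intact;
    \<open>left\<close> is the mirror image.\<close>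
  have right: "nf (u1 @ X @ m @ g # h # v) s = reduct (u1 @ X @ m) g h v s"
    if "(u1 @ X @ m @ g # h # v, u1 @ g1 # h1 # m @ g # h # v) \<in> word_rel" for X
    using that r by (intro IH) (auto simp: is_redex_def)
  have left: "nf (u1 @ g1 # h1 # m @ Y @ v) s = reduct u1 g1 h1 (m @ Y @ v) s"
    if "(u1 @ g1 # h1 # m @ Y @ v, u1 @ g1 # h1 # m @ g # h # v) \<in> word_rel" for Y
    using that r1 by (intro IH) (auto simp: is_redex_def)
  have right_eqs:
    "nf (u1 @ h1 # g1 # m @ g # h # v) s = reduct (u1 @ h1 # g1 # m) g h v s"
    "nf (u1 @ other_gen g1 h1 # m @ g # h # v) s = reduct (u1 @ other_gen g1 h1 # m) g h v s"
    "nf (u1 @ m @ g # h # v) s = reduct (u1 @ m) g h v s"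
    using right[of "[h1, g1]"] right[of "[other_gen g1 h1]"] right[of "[]"]
      word_rel_swap[OF r1, of u1 "m @ g # h # v"] by (simp_all add: word_rel_shorter)
  have left_eqs:
    "nf (u1 @ g1 # h1 # m @ h # g # v) s = reduct u1 g1 h1 (m @ h # g # v) s"
    "nf (u1 @ g1 # h1 # m @ other_gen g h # v) s = reduct u1 g1 h1 (m @ other_gen g h # v) s"
    "nf (u1 @ g1 # h1 # m @ v) s = reduct u1 g1 h1 (m @ v) s"
    using left[of "[h, g]"] left[of "[other_gen g h]"] left[of "[]"]
      word_rel_swap[OF r, of "u1 @ g1 # h1 # m" "v"] by (simp_all add: word_rel_shorter)
  have "reduct u1 g1 h1 (m @ g # h # v) s =
      swap_coeff g1 h1 * reduct (u1 @ h1 # g1 # m) g h v s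
      + gen_coeff g1 h1 * reduct (u1 @ other_gen g1 h1 # m) g h v s
      + const_coeff g1 h1 * reduct (u1 @ m) g h v s"
    unfolding reduct_def[of u1] right_eqs ..
  also have "\<dots> = swap_coeff g h * reduct u1 g1 h1 (m @ h # g # v) s
      + gen_coeff g h * reduct u1 g1 h1 (m @ other_gen g h # v) s
      + const_coeff g h * reduct u1 g1 h1 (m @ v) s"
    unfolding reduct_def by (simp add: algebra_simps)
  also have "\<dots> = reduct (u1 @ g1 # h1 # m) g h v s"
    unfolding reduct_def[of "u1 @ g1 # h1 # m"] by (simp add: left_eqs)
  finally show ?thesis .
qed

text \<open>The only critical pair. Since \<open>Q * Q' = 1\<close>, both ways of reducing
  \<open>CBA\<close> end in \<open>Q ABC + a AA - a BB + a CC - x A + y B - z C\<close>.\<close>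

lemma overlap_reducts_agree:
  assumes IH: "\<And>w' u g h v. (w', u1 @ GC # GB # GA # v1) \<in> word_rel \<Longrightarrow>
      is_redex w' (u, g, h, v) \<Longrightarrow> nf w' s = reduct u g h v s"
  shows "reduct u1 GC GB (GA # v1) s = reduct (u1 @ [GC]) GB GA v1 s"
proof -
  let ?w = "u1 @ GC # GB # GA # v1"
  have less: "(u1 @ GB # GC # GA # v1, ?w) \<in> word_rel" "(u1 @ GB # GA # GC # v1, ?w) \<in> word_rel"
    "(u1 @ GC # GA # GB # v1, ?w) \<in> word_rel" "(u1 @ GA # GC # GB # v1, ?w) \<in> word_rel"
    by (simp_all add: word_rel_def irrefl_def Cons_lenlex_iff)
  have eqs:
    "nf (u1 @ GB # GC # GA # v1) s = reduct (u1 @ [GB]) GC GA v1 s"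
    "nf (u1 @ GB # GA # GC # v1) s = reduct u1 GB GA (GC # v1) s"
    "nf (u1 @ GC # GA # GB # v1) s = reduct u1 GC GA (GB # v1) s"
    "nf (u1 @ GA # GC # GB # v1) s = reduct (u1 @ [GA]) GC GB v1 s"
    by (rule IH[OF less(1)], simp add: is_redex_def)
      (rule IH[OF less(2)], simp add: is_redex_def,
       rule IH[OF less(3)], simp add: is_redex_def,
       rule IH[OF less(4)], simp add: is_redex_def)
  have cancel: "Q * (Q' * t) = t" for t
    using QQ' by (simp flip: mult.assoc)
  show ?thesis
    by (simp add: reduct_def eqs swap_coeff_def gen_coeff_def const_coeff_def algebra_simps cancel)
qed

lemma reducts_agree:
  assumes IH: "\<And>w' u g h v. (w', w) \<in> word_rel \<Longrightarrow>
      is_redex w' (u, g, h, v) \<Longrightarrow> nf w' s = reduct u g h v s"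
    and 1: "is_redex w (u1, g1, h1, v1)" and 2: "is_redex w (u2, g2, h2, v2)"
    and le: "length u1 \<le> length u2"
  shows "reduct u1 g1 h1 v1 s = reduct u2 g2 h2 v2 s"
proof -
  from 1 2 have w: "w = u1 @ g1 # h1 # v1" "u1 @ g1 # h1 # v1 = u2 @ g2 # h2 # v2"
    and r: "gen_rank h1 < gen_rank g1" "gen_rank h2 < gen_rank g2"
    by (auto simp: is_redex_def)
  from w(2) le obtain m where m: "u2 = u1 @ m" "g1 # h1 # v1 = m @ g2 # h2 # v2"
    by (auto simp: append_eq_append_conv2)
  consider "m = []" | "m = [g1]" | m' where "m = g1 # h1 # m'"
    using m(2) by (cases m; cases "tl m") auto
  then show ?thesis
  proof cases
    case 1
    with m show ?thesis by simp
  next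
    case 2
    \<comment> \<open>The redexes share the letter \<open>h1 = g2\<close>, so the rank drops twice
      along three letters, which forces \<open>CBA\<close>.\<close>
    with m r have "g1 = GC" "h1 = GB" "g2 = GB" "h2 = GA"
      by (cases g1; cases g2; cases h2; simp)+
    with 2 m w show ?thesis
      using overlap_reducts_agree[of u1 v2 s] IH by simp
  next
    case 3
    with m w r show ?thesis
      using disjoint_reducts_agree[of u1 g1 h1 m' g2 h2 v2 s] IH by simp
  qed
qed

text \<open>Local confluence and well-founded induction: the chosen redex and any other one give the
  same value. The two instances of \<open>reducts_agree\<close> cover both orders of their
  positions.\<close>

lemma nf_reduct: "is_redex w (u, g, h, v) \<Longrightarrow> nf w s = reduct u g h v s"
proof (induction w arbitrary: u g h v rule: wf_induct_rule[OF wf_word_rel])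
  case (1 w)
  obtain u1 g1 h1 v1 where d: "is_redex w (u1, g1, h1, v1)" "\<And>s. nf w s = reduct u1 g1 h1 v1 s"
    using nf_some_redex[OF "1.prems"] by blast
  show ?case
    using reducts_agree[OF "1.IH" d(1) "1.prems"] reducts_agree[OF "1.IH" "1.prems" d(1)] d(2)
    by (metis nle_le)
qed

lemma nf_BA: "nf (u @ GB # GA # v) s = Q * nf (u @ GA # GB # v) s + a * nf (u @ GC # v) s - z * nf (u @ v) s"
  and nf_CB: "nf (u @ GC # GB # v) s = Q * nf (u @ GB # GC # v) s + a * nf (u @ GA # v) s - x * nf (u @ v) s"
  and nf_CA: "nf (u @ GC # GA # v) s = Q' * (nf (u @ GA # GC # v) s - a * nf (u @ GB # v) s + y * nf (u @ v) s)"
  using nf_reduct[of "u @ GB # GA # v" u GB GA v s] nf_reduct[of "u @ GC # GB # v" u GC GB v s]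
    nf_reduct[of "u @ GC # GA # v" u GC GA v s]
  by (simp_all add: is_redex_def reduct_def swap_coeff_def gen_coeff_def const_coeff_def algebra_simps)

text \<open>No rule lengthens a word, so the normal form of \<open>w\<close> contains no word longer
  than \<open>w\<close>.\<close>

lemma nf_eq_0_if_longer: "length w < length s \<Longrightarrow> nf w s = 0"
proof (induction w rule: wf_induct_rule[OF wf_word_rel])
  case (1 w)
  show ?case
  proof (cases "reducible w")
    case False
    with 1 show ?thesis by (auto simp: nf_irreducible)
  next
    case True
    then obtain u g h v where d: "is_redex w (u, g, h, v)" "\<And>s. nf w s = reduct u g h v s"
      using nf_some_redex some_redex by metis
    then have w: "w = u @ g # h # v" and r: "gen_rank h < gen_rank g" by (auto simp: is_redex_def)
    show ?thesis
      unfolding d(2) reduct_def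
      using 1 word_rel_swap[OF r, of u v] word_rel_shorter[of "u @ v" w]
        word_rel_shorter[of "u @ other_gen g h # v" w]
      by (simp add: w)
  qed
qed

end

section \<open>The free algebra as a ring\<close>

text \<open>Concatenation is written additively so that the convolution product of
  \<open>poly_mapping\<close> becomes the product of the free algebra.\<close>

instantiation list :: (type) monoid_add
begin
definition plus_list :: "'a list \<Rightarrow> 'a list \<Rightarrow> 'a list" where "plus_list = (@)"
definition zero_list :: "'a list" where "zero_list = []"
instance by standard (simp_all add: plus_list_def zero_list_def)
end

type_synonym 'a free_alg = "gen list \<Rightarrow>\<^sub>0 'a"

abbreviation lk :: "'a::zero free_alg \<Rightarrow> 'a fa" where "lk \<equiv> Poly_Mapping.lookup"

abbreviation word :: "gen list \<Rightarrow> 'a::field free_alg" where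
  "word w \<equiv> Poly_Mapping.single w 1"

abbreviation const :: "'a::field \<Rightarrow> 'a free_alg" where
  "const c \<equiv> Poly_Mapping.single [] c"

lemma free_alg_induct [case_names single add]:
  assumes "\<And>w c. P (Poly_Mapping.single w c)" and "\<And>x y. P x \<Longrightarrow> P y \<Longrightarrow> P (x + y)"
  shows "P (x :: 'a::field free_alg)"
proof (induction x rule: update_induct)
  case const
  show ?case using assms(1)[of "[]" 0] by simp
next
  case (update f a b)
  have "Poly_Mapping.update a b f = f + Poly_Mapping.single a b"
    using update(1) by (intro poly_mapping_eqI)
      (auto simp: lookup_update lookup_add lookup_single when_def in_keys_iff)
  with assms update show ?case by simp
qed

lemma single_mult: "Poly_Mapping.single u c * Poly_Mapping.single v d
    = (Poly_Mapping.single (u @ v) (c * d) :: 'a::field free_alg)"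
  by (simp add: mult_single plus_list_def)

lemma one_free_alg: "(1 :: 'a::field free_alg) = const 1"
  by (metis single_one zero_list_def)

lemma const_commute: "x * const c = const c * (x :: 'a::field free_alg)"
  by (induction x rule: free_alg_induct) (simp_all add: single_mult mult.commute algebra_simps)

lemma const_left_commute: "x * (const c * y) = const c * (x * (y :: 'a::field free_alg))"
  by (simp flip: mult.assoc add: const_commute)

text \<open>Of all splits in the convolution, only the one after \<open>length u\<close> letters can
  meet both supports.\<close>

lemma fa_mult_single:
  "fa_mult (lk (Poly_Mapping.single u c)) (lk (Poly_Mapping.single v d))
    = lk (Poly_Mapping.single (u @ v) (c * d :: 'a::field))"
proof
  fix w
  show "fa_mult (lk (Poly_Mapping.single u c)) (lk (Poly_Mapping.single v d)) w
      = lk (Poly_Mapping.single (u @ v) (c * d)) w"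
  proof (cases "w = u @ v")
    case True
    have "u \<noteq> take i w" if "i \<le> length w" "i \<noteq> length u" for i
      using that by auto
    then have "(\<Sum>i\<le>length w. lk (Poly_Mapping.single u c) (take i w) * lk (Poly_Mapping.single v d) (drop i w))
        = (\<Sum>i\<in>{length u}. lk (Poly_Mapping.single u c) (take i w) * lk (Poly_Mapping.single v d) (drop i w))"
      by (intro sum.mono_neutral_right ballI) (simp_all add: True lookup_single_not_eq)
    with True show ?thesis by (simp add: fa_mult_def)
  next
    case False
    then have zero: "lk (Poly_Mapping.single u c) (take i w) * lk (Poly_Mapping.single v d) (drop i w) = 0" for i
      using append_take_drop_id[of i w] by (auto simp: lookup_single when_def)
    show ?thesis
      unfolding fa_mult_def zero using False by (simp add: lookup_single_not_eq)
  qed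
qed

lemma lookup_add_fa: "lk (x + y) = fa_add (lk x) (lk (y :: 'a::field free_alg))"
  by (simp add: fa_add_def lookup_add fun_eq_iff)

lemma lookup_diff_fa: "lk (x - y) = fa_diff (lk x) (lk (y :: 'a::field free_alg))"
  by (simp add: fa_diff_def lookup_minus fun_eq_iff)

lemma lookup_mult_fa: "lk (x * y) = fa_mult (lk x) (lk (y :: 'a::field free_alg))"
proof (induction x rule: free_alg_induct)
  case (single u c)
  show ?case
  proof (induction y rule: free_alg_induct)
    case (single v d)
    show ?case by (simp add: fa_mult_single single_mult)
  next
    case (add y z)
    then show ?case
      by (simp add: algebra_simps lookup_add_fa)
        (simp add: fa_add_def fa_mult_def algebra_simps sum.distrib)
  qed
next
  case (add x z)
  then show ?case
    by (simp add: algebra_simps lookup_add_fa)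
      (simp add: fa_add_def fa_mult_def algebra_simps sum.distrib)
qed

lemma fa_mult_const: "fa_mult (lk (const c)) f = fa_smult c f"
proof
  fix w
  have "(\<Sum>i\<le>length w. lk (const c) (take i w) * f (drop i w)) = (\<Sum>i\<in>{0::nat}. c * f w)"
    by (rule sum.mono_neutral_cong_right) (auto simp: lookup_single when_def)
  then show "fa_mult (lk (const c)) f w = fa_smult c f w"
    by (simp add: fa_mult_def fa_smult_def)
qed

lemma lookup_const_mult: "lk (const c * x) = fa_smult c (lk (x :: 'a::field free_alg))"
  by (simp add: lookup_mult_fa fa_mult_const)

lemma lookup_word: "lk (word w) = fa_word w"
  by (auto simp: fa_word_def lookup_single when_def fun_eq_iff)

lemma lookup_power_fa: "lk (x ^ n) = fa_pow (lk (x :: 'a::field free_alg)) n"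
proof (induction n)
  case 0
  then show ?case by (auto simp: one_free_alg fa_one_def lookup_single when_def fun_eq_iff)
qed (simp add: lookup_mult_fa)

lemma lookup_sum_fa: "lk (\<Sum>x\<in>S. F x) = fa_sum S (\<lambda>x. lk (F x :: 'a::field free_alg))"
  by (simp add: fa_sum_def lookup_sum fun_eq_iff)

lemma lookup_0_fa: "lk (0 :: 'a::field free_alg) = fa_zero"
  by (simp add: fa_zero_def fun_eq_iff)

section \<open>The elements \<alpha>, \<beta>, \<gamma>, \<Omega> and the monomials inside the
  ring\<close>

fun next_gen :: "gen \<Rightarrow> gen" where
  "next_gen GA = GB" | "next_gen GB = GC" | "next_gen GC = GA"

text \<open>One formula for \<alpha>, \<beta>, \<gamma>, indexed by their linear letters
  \<open>GA\<close>, \<open>GB\<close>, \<open>GC\<close>, using the cyclic symmetry of the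
  relations.\<close>

definition cen :: "'a::field \<Rightarrow> gen \<Rightarrow> 'a free_alg" where
  "cen q g = const (q + inverse q) * (word [g] + const (inverse (q^2 - inverse q ^ 2)) *
     (const q * (word [next_gen g] * word [next_gen (next_gen g)])
      - const (inverse q) * (word [next_gen (next_gen g)] * word [next_gen g])))"

definition omega :: "'a::field \<Rightarrow> 'a free_alg" where
  "omega q = const q * (word [GA] * (word [GB] * word [GC]))
     + const (q^2) * (word [GA] * word [GA])
     + const (inverse q ^ 2) * (word [GB] * word [GB])
     + const (q^2) * (word [GC] * word [GC])
     - const q * (word [GA] * cen q GA)
     - const (inverse q) * (word [GB] * cen q GB)
     - const q * (word [GC] * cen q GC)"

definition sorted_word :: "nat \<Rightarrow> nat \<Rightarrow> nat \<Rightarrow> gen list" where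
  "sorted_word i j k = replicate i GA @ replicate j GB @ replicate k GC"

definition aw_monom :: "'a::field \<Rightarrow> idx7 \<Rightarrow> 'a free_alg" where
  "aw_monom q = (\<lambda>(i,j,k,l,r,s,t). word (sorted_word i j k) * omega q ^ l *
     (cen q GA ^ r * (cen q GB ^ s * cen q GC ^ t)))"

lemma lookup_cen:
  "lk (cen q GA) = aw_alpha q" "lk (cen q GB) = aw_beta q" "lk (cen q GC) = aw_gamma q"
  by (simp_all add: cen_def aw_alpha_def aw_beta_def aw_gamma_def aw_xA_def aw_xB_def aw_xC_def
      aw_x_def fa_mult_const lookup_add_fa lookup_diff_fa lookup_mult_fa lookup_word fa_gen_def)

lemma lookup_omega: "lk (omega q) = aw_Omega q"
  by (simp add: omega_def aw_Omega_def fa_mult_const lookup_add_fa lookup_diff_fa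
      lookup_mult_fa lookup_word fa_gen_def aw_A_def aw_B_def aw_C_def lookup_cen)

lemma word_power: "word [g] ^ n = word (replicate n g)"
  by (induction n) (simp_all add: one_free_alg single_mult)

lemma lookup_aw_monom: "lk (aw_monom q x) = aw_mono q x"
proof -
  obtain i j k l r s t where x: "x = (i,j,k,l,r,s,t)" by (metis prod_cases7)
  have "aw_monom q x = word [GA] ^ i * (word [GB] ^ j * (word [GC] ^ k *
      (omega q ^ l * (cen q GA ^ r * (cen q GB ^ s * cen q GC ^ t)))))"
    by (simp add: x aw_monom_def sorted_word_def word_power single_mult flip: mult.assoc)
  then show ?thesis
    by (simp add: x aw_mono_def lookup_mult_fa lookup_power_fa lookup_cen lookup_omega
        lookup_word aw_A_def aw_B_def aw_C_def fa_gen_def)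
qed

section \<open>The defining ideal and centrality modulo it\<close>

definition ideal :: "'a::field \<Rightarrow> 'a free_alg set" where
  "ideal q = {x. lk x \<in> aw_ideal q}"

lemma ideal_0: "0 \<in> ideal q"
  by (simp add: ideal_def lookup_0_fa aw_ideal.zero)

lemma ideal_add: "x \<in> ideal q \<Longrightarrow> y \<in> ideal q \<Longrightarrow> x + y \<in> ideal q"
  by (simp add: ideal_def lookup_add_fa aw_ideal.add)

lemma ideal_const: "x \<in> ideal q \<Longrightarrow> const c * x \<in> ideal q"
  by (simp add: ideal_def lookup_const_mult aw_ideal.smult)

lemma minus_conv_const: "- x = const (-1) * (x :: 'a::field free_alg)"
  using one_free_alg[where 'a='a] by (simp add: single_uminus)

lemma ideal_uminus: "x \<in> ideal q \<Longrightarrow> - x \<in> ideal q"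
  unfolding minus_conv_const[of x] by (rule ideal_const)

lemma ideal_word: "x \<in> ideal q \<Longrightarrow> word u * x * word v \<in> ideal q"
  by (simp add: ideal_def lookup_mult_fa lookup_word mult.assoc aw_ideal.mult)

lemma single_eq_const: "Poly_Mapping.single w c = const c * word w"
  by (simp add: single_mult)

text \<open>The rules of \<open>aw_ideal\<close> allow only words as factors; arbitrary factors
  follow by linearity.\<close>

lemma ideal_mult_left: "x \<in> ideal q \<Longrightarrow> y * x \<in> ideal q"
proof (induction y rule: free_alg_induct)
  case (single w c)
  then show ?case
    using ideal_const[OF ideal_word[of x q w "[]"], of c]
    by (subst single_eq_const) (simp add: mult.assoc flip: one_free_alg)
qed (simp add: distrib_right ideal_add)

lemma ideal_mult_right: "x \<in> ideal q \<Longrightarrow> x * y \<in> ideal q"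
proof (induction y rule: free_alg_induct)
  case (single w c)
  then show ?case
    using ideal_const[OF ideal_word[of x q "[]" w], of c]
    by (subst single_eq_const) (simp add: mult.assoc const_left_commute flip: one_free_alg)
qed (simp add: distrib_left ideal_add)

lemma cen_gen_commute: "cen q g * word [h] - word [h] * cen q g \<in> ideal q"
proof -
  define X where "X = word [g] + const (inverse (q^2 - inverse q ^ 2)) *
     (const q * (word [next_gen g] * word [next_gen (next_gen g)])
      - const (inverse q) * (word [next_gen (next_gen g)] * word [next_gen g]))"
  have "lk X = aw_x q g (next_gen g) (next_gen (next_gen g))"
    by (simp add: X_def aw_x_def fa_mult_const lookup_add_fa lookup_diff_fa
        lookup_mult_fa lookup_word fa_gen_def)
  then have "lk X \<in> {aw_xA q, aw_xB q, aw_xC q}"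
    by (cases g) (simp_all add: aw_xA_def aw_xB_def aw_xC_def)
  then have "fa_comm (lk X) (fa_gen h) \<in> aw_relators q"
    unfolding aw_relators_def by blast
  then have "X * word [h] - word [h] * X \<in> ideal q"
    by (simp add: ideal_def aw_ideal.rel fa_comm_def lookup_diff_fa lookup_mult_fa lookup_word fa_gen_def)
  moreover have "cen q g * word [h] - word [h] * cen q g
      = const (q + inverse q) * (X * word [h] - word [h] * X)"
    unfolding cen_def X_def[symmetric]
    by (simp add: right_diff_distrib mult.assoc const_left_commute)
  ultimately show ?thesis by (simp add: ideal_const)
qed

text \<open>Commuting spreads from letters to words because a commutator acts on \<open>h w\<close>
  by the product rule, and from words to all elements by linearity.\<close>

lemma cen_commute: "cen q g * x - x * cen q g \<in> ideal q"
proof (induction x rule: free_alg_induct)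
  case (single w c)
  have "cen q g * word w - word w * cen q g \<in> ideal q"
  proof (induction w)
    case Nil
    then show ?case by (simp add: ideal_0 flip: one_free_alg)
  next
    case (Cons h w)
    have "word (h # w) = word [h] * (word w :: 'a free_alg)" by (simp add: single_mult)
    then have "cen q g * word (h # w) - word (h # w) * cen q g
       = (cen q g * word [h] - word [h] * cen q g) * word w
         + word [h] * (cen q g * word w - word w * cen q g)"
      by (simp add: algebra_simps)
    with Cons show ?case
      by (simp add: ideal_add ideal_mult_left ideal_mult_right cen_gen_commute)
  qed
  then have "const c * (cen q g * word w - word w * cen q g) \<in> ideal q" by (rule ideal_const)
  then show ?case
    by (subst (1 2) single_eq_const) (simp add: right_diff_distrib mult.assoc const_left_commute)
next
  case (add x y)
  from ideal_add[OF this] show ?case by (simp add: algebra_simps)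
qed

lemma cen_move: "x * cen q g * y - cen q g * (x * y) \<in> ideal q"
  using ideal_mult_right[OF ideal_uminus[OF cen_commute[of q g x]], of y]
  by (simp add: algebra_simps)

text \<open>Degree less than \<open>n\<close> modulo the ideal, where \<open>\<alpha>, \<beta>, \<gamma>\<close> count as scalars.\<close>

inductive_set lower :: "'a::field \<Rightarrow> nat \<Rightarrow> 'a free_alg set" for q n where
  lower_ideal: "x \<in> ideal q \<Longrightarrow> x \<in> lower q n"
| lower_word: "length w < n \<Longrightarrow> word w \<in> lower q n"
| lower_add: "x \<in> lower q n \<Longrightarrow> y \<in> lower q n \<Longrightarrow> x + y \<in> lower q n"
| lower_const: "x \<in> lower q n \<Longrightarrow> const c * x \<in> lower q n"
| lower_cen: "x \<in> lower q n \<Longrightarrow> cen q g * x \<in> lower q n"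

lemma lower_mono: "x \<in> lower q m \<Longrightarrow> m \<le> n \<Longrightarrow> x \<in> lower q n"
  by (induction rule: lower.induct) (auto intro: lower.intros)

lemma lower_uminus: "x \<in> lower q n \<Longrightarrow> - x \<in> lower q n"
  unfolding minus_conv_const[of x] by (rule lower_const)

lemma lower_diff: "x \<in> lower q n \<Longrightarrow> y \<in> lower q n \<Longrightarrow> x - y \<in> lower q n"
  using lower_add[of x q n "- y"] lower_uminus[of y q n] by simp

lemma lower_trans: "x - y \<in> lower q n \<Longrightarrow> y \<in> lower q n \<Longrightarrow> x \<in> lower q n"
  using lower_add[of "x - y" q n y] by simp

text \<open>Modulo the ideal the central factor moves to the front, where \<open>lower_cen\<close>
  applies.\<close>

lemma lower_cen_middle: "x * y \<in> lower q n \<Longrightarrow> x * cen q g * y \<in> lower q n"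
  using lower_trans[OF lower_ideal[OF cen_move]] lower_cen by blast

section \<open>Leading terms and spanning\<close>

lemma q_conds:
  assumes "(q::'a::field) \<noteq> 0" "q ^ 4 \<noteq> 1"
  shows "q + inverse q \<noteq> 0" "q - inverse q \<noteq> 0" "q^2 - inverse q ^ 2 \<noteq> 0"
    "q^2 - inverse q ^ 2 = (q + inverse q) * (q - inverse q)"
proof -
  show eq: "q^2 - inverse q ^ 2 = (q + inverse q) * (q - inverse q)"
    using assms by (simp add: algebra_simps power2_eq_square)
  have "q ^ 2 * (q^2 - inverse q ^ 2) = q ^ 4 - 1"
    using assms by (simp add: field_simps flip: power_add)
  then show "q^2 - inverse q ^ 2 \<noteq> 0" using assms by auto
  then show "q + inverse q \<noteq> 0" "q - inverse q \<noteq> 0" using eq by auto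
qed

lemma cen_expand:
  "cen q g = Poly_Mapping.single [g] (q + inverse q)
     + Poly_Mapping.single [next_gen g, next_gen (next_gen g)]
         ((q + inverse q) * (inverse (q^2 - inverse q ^ 2) * q))
     - Poly_Mapping.single [next_gen (next_gen g), next_gen g]
         ((q + inverse q) * (inverse (q^2 - inverse q ^ 2) * inverse q))"
  unfolding cen_def by (simp add: single_mult algebra_simps)

text \<open>The central element \<open>cen q (other_gen g h)\<close> is a combination of its letter
  and the words \<open>g h\<close> and \<open>h g\<close>, so it can be solved for
  \<open>g h\<close>.\<close>

lemma swap_relation:
  fixes q :: "'a::field"
  assumes q: "q \<noteq> 0" "q ^ 4 \<noteq> 1" and r: "gen_rank h < gen_rank g"
  obtains c1 c2 c3 where "c1 \<noteq> 0"
    "word [g, h] = const c1 * word [h, g] + const c2 * word [other_gen g h] + const c3 * cen q (other_gen g h)"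
proof -
  define e d where "e = q + inverse q" and "d = q^2 - inverse q ^ 2"
  have nz: "e \<noteq> 0" "d \<noteq> 0" using q_conds[OF q] by (auto simp: e_def d_def)
  have cen: "cen q t = Poly_Mapping.single [t] e
     + Poly_Mapping.single [next_gen t, next_gen (next_gen t)] (e * (inverse d * q))
     - Poly_Mapping.single [next_gen (next_gen t), next_gen t] (e * (inverse d * inverse q))" for t
    unfolding cen_expand e_def d_def ..
  have d: "d * (a * (b * inverse d)) = a * b" "d * (a * (inverse d * b)) = a * b"
      "d * (inverse d * a) = a" for a b
    using nz by (simp_all add: field_simps)
  consider "g = GB" "h = GA" | "g = GC" "h = GB" | "g = GC" "h = GA"
    using r by (cases g; cases h) auto
  \<comment> \<open>The constants arise on dividing by the coefficient of the descent in
    \<open>cen\<close>: \<open>- e / (d * q)\<close> for \<open>BA\<close> and \<open>CB\<close>,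
    and \<open>e * q / d\<close> for \<open>CA\<close>.\<close>
  then show thesis
  proof cases
    case 1
    show thesis
      by (rule that[of "q^2" "q * d" "- (q * d / e)"])
        (use q nz 1 in \<open>simp_all add: cen d single_mult algebra_simps
            power2_eq_square single_uminus flip: single_add\<close>)
  next
    case 2
    show thesis
      by (rule that[of "q^2" "q * d" "- (q * d / e)"])
        (use q nz 2 in \<open>simp_all add: cen d single_mult algebra_simps
            power2_eq_square single_uminus flip: single_add\<close>)
  next
    case 3
    show thesis
      by (rule that[of "inverse q ^ 2" "- (inverse q * d)" "inverse q * d / e"])
        (use q nz 3 in \<open>simp_all add: cen d single_mult algebra_simps
            power2_eq_square single_uminus flip: single_add\<close>)
  qed
qed

text \<open>The linear term of the rule is one letter shorter, and the central term two letters
  shorter since its central factor has degree 0.\<close>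

lemma swap_lower:
  fixes q :: "'a::field"
  assumes q: "q \<noteq> 0" "q ^ 4 \<noteq> 1" and r: "gen_rank h < gen_rank g"
  obtains c where "c \<noteq> 0"
    "word (u @ g # h # v) - const c * word (u @ h # g # v) \<in> lower q (length (u @ g # h # v))"
proof -
  let ?n = "length (u @ g # h # v)" and ?t = "other_gen g h"
  obtain c1 c2 c3 where c: "c1 \<noteq> 0"
    "word [g, h] = const c1 * word [h, g] + const c2 * word [?t] + const c3 * cen q ?t"
    by (rule swap_relation[OF q r])
  have split: "word (u @ w @ v) = word u * word w * (word v :: 'a free_alg)" for w
    by (simp add: single_mult)
  have "word (u @ g # h # v) = word u * word [g, h] * (word v :: 'a free_alg)"
    using split[of "[g, h]"] by simp
  also have "\<dots> = const c1 * word (u @ [h, g] @ v) + const c2 * word (u @ [?t] @ v)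
      + const c3 * (word u * cen q ?t * word v)"
    unfolding c(2) split by (simp add: ring_distribs mult.assoc const_left_commute del: append.simps)
  finally have "word (u @ g # h # v) - const c1 * word (u @ h # g # v)
      = const c2 * word (u @ [?t] @ v) + const c3 * (word u * cen q ?t * word v)"
    by simp
  also have "\<dots> \<in> lower q ?n"
  proof (intro lower_add lower_const lower_word lower_cen_middle)
    show "word u * word v \<in> lower q ?n" by (simp add: single_mult lower_word)
  qed simp
  finally show thesis using that c(1) by blast
qed

section \<open>Leading words\<close>

definition sort_word :: "gen list \<Rightarrow> gen list" where
  "sort_word w = sorted_word (count_list w GA) (count_list w GB) (count_list w GC)"

lemma length_sort_word: "length (sort_word w) = length w"
proof (induction w)
  case (Cons g w)
  then show ?case by (cases g) (simp_all add: sort_word_def sorted_word_def)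
qed (simp add: sort_word_def sorted_word_def)

lemma length_sorted_word: "length (sorted_word i j k) = i + j + k"
  by (simp add: sorted_word_def)

lemma count_list_replicate: "count_list (replicate n x) y = (if x = y then n else 0)"
  by (induction n) auto

lemma count_sorted_word [simp]:
  "count_list (sorted_word i j k) GA = i" "count_list (sorted_word i j k) GB = j"
  "count_list (sorted_word i j k) GC = k"
  by (simp_all add: sorted_word_def count_list_replicate)

lemma irreducible_sort_word: "\<not> reducible w \<Longrightarrow> sort_word w = w"
proof (induction w)
  case Nil
  then show ?case by (simp add: sort_word_def sorted_word_def)
next
  case (Cons g w)
  have irr: "\<not> is_redex (g # w) d" for d using Cons.prems unfolding reducible_def by blast
  have "\<not> reducible w"
  proof
    assume "reducible w"
    then obtain u g' h v where "is_redex w (u, g', h, v)" by (auto simp: reducible_def)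
    then have "is_redex (g # w) (g # u, g', h, v)" by (auto simp: is_redex_def)
    with irr show False by blast
  qed
  with Cons have IH: "sort_word w = w" by simp
  show ?case
  proof (cases w)
    case Nil
    then show ?thesis by (cases g) (simp_all add: sort_word_def sorted_word_def)
  next
    case (Cons h w')
    have "gen_rank g \<le> gen_rank h"
      using irr[of "([], g, h, w')"] Cons by (simp add: is_redex_def)
    moreover have "hd (sort_word w) = h" using IH Cons by simp
    ultimately show ?thesis
      using IH Cons
      by (cases g; cases "count_list w GA"; cases "count_list w GB")
        (auto simp: sort_word_def sorted_word_def split: if_splits)
  qed
qed

text \<open>Each swap of a descent costs a nonzero factor and an error of lower degree, while the
  letter counts and hence \<open>sort_word\<close> stay the same.\<close>

lemma word_leading:
  fixes q :: "'a::field"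
  assumes q: "q \<noteq> 0" "q ^ 4 \<noteq> 1"
  shows "\<exists>c. c \<noteq> 0 \<and> word w - const c * word (sort_word w) \<in> lower q (length w)"
proof (induction w rule: wf_induct_rule[OF wf_word_rel])
  case (1 w)
  show ?case
  proof (cases "reducible w")
    case False
    have "word w - const 1 * word (sort_word w) \<in> lower q (length w)"
      using irreducible_sort_word[OF False]
      by (simp add: lower_ideal ideal_0 flip: one_free_alg)
    then show ?thesis using zero_neq_one by metis
  next
    case True
    then obtain u g h v where w: "w = u @ g # h # v" and r: "gen_rank h < gen_rank g"
      by (auto simp: reducible_def is_redex_def)
    let ?w' = "u @ h # g # v"
    obtain c where c: "c \<noteq> 0" "word w - const c * word ?w' \<in> lower q (length w)"
      using swap_lower[OF q r] unfolding w by metis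
    have "(?w', w) \<in> word_rel" unfolding w by (rule word_rel_swap[OF r])
    from 1[OF this] obtain c' where c': "c' \<noteq> 0"
      "word ?w' - const c' * word (sort_word ?w') \<in> lower q (length ?w')" by blast
    have "sort_word ?w' = sort_word w" "length ?w' = length w" by (simp_all add: w sort_word_def)
    with c' have "const c * (word ?w' - const c' * word (sort_word w)) \<in> lower q (length w)"
      by (simp add: lower_const)
    from lower_add[OF c(2) this]
    have "word w - const (c * c') * word (sort_word w) \<in> lower q (length w)"
      by (simp add: right_diff_distrib single_mult flip: mult.assoc)
    with c(1) c'(1) show ?thesis by (metis mult_eq_0_iff)
  qed
qed

lemma lower_Suc_if_leading:
  assumes "x - const c * word w \<in> lower q n" "length w \<le> n"
  shows "x \<in> lower q (Suc n)"
  using lower_trans[of x "const c * word w"] assms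
  by (simp add: lower_mono[of _ q n] lower_const lower_word)

text \<open>When one \<Omega> is multiplied out, only \<open>q ABC\<close> adds three letters; the
  squares add two, and the terms with \<alpha>, \<beta>, \<gamma> add one. The word \<open>u\<close>
  is arbitrary so that it can absorb these letters in the induction.\<close>

lemma omega_leading:
  fixes q :: "'a::field"
  assumes q: "q \<noteq> 0" "q ^ 4 \<noteq> 1"
  shows "\<exists>c. c \<noteq> 0 \<and> word u * omega q ^ l
      - const c * word (sorted_word (count_list u GA + l) (count_list u GB + l) (count_list u GC + l))
      \<in> lower q (length u + 3 * l)"
proof (induction l arbitrary: u)
  case 0
  then show ?case using word_leading[OF q, of u] by (simp add: sort_word_def)
next
  case (Suc l)
  let ?n = "length u + 3 * Suc l" and ?O = "omega q ^ l"
  let ?s = "sorted_word (count_list u GA + Suc l) (count_list u GB + Suc l) (count_list u GC + Suc l)"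
  \<comment> \<open>Degrees in \<open>lower q ?n\<close> are strictly below \<open>?n\<close>, which
    counts three letters for the new \<Omega>; two extra letters therefore still fit.\<close>
  have low: "word (u @ v) * ?O \<in> lower q ?n" if "length v \<le> 2" for v
  proof -
    obtain c where "word (u @ v) * ?O - const c * word (sorted_word (count_list (u @ v) GA + l)
        (count_list (u @ v) GB + l) (count_list (u @ v) GC + l)) \<in> lower q (length (u @ v) + 3 * l)"
      using Suc[of "u @ v"] by blast
    from lower_Suc_if_leading[OF this] 
    have "word (u @ v) * ?O \<in> lower q (Suc (length (u @ v) + 3 * l))"
      using length_sort_word[of "u @ v"] by (simp add: sort_word_def length_sorted_word)
    then show ?thesis by (rule lower_mono) (use that in simp)
  qed
  have low_cen: "word (u @ [g]) * cen q g * ?O \<in> lower q ?n" for g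
    by (rule lower_cen_middle, rule low) simp
  have n: "?n = length (u @ [GA, GB, GC]) + 3 * l" by simp
  obtain c where c: "c \<noteq> 0" "word (u @ [GA, GB, GC]) * ?O - const c * word ?s \<in> lower q ?n"
    using Suc[of "u @ [GA, GB, GC]"] unfolding n by auto
  have split: "word u' * (word v * x) = word (u' @ v) * (x :: 'a free_alg)" for u' v x
    by (simp add: single_mult flip: mult.assoc)
  have "word u * omega q ^ Suc l = const q * (word (u @ [GA, GB, GC]) * ?O)
     + const (q^2) * (word (u @ [GA, GA]) * ?O)
     + const (inverse q ^ 2) * (word (u @ [GB, GB]) * ?O)
     + const (q^2) * (word (u @ [GC, GC]) * ?O)
     - const q * (word (u @ [GA]) * cen q GA * ?O)
     - const (inverse q) * (word (u @ [GB]) * cen q GB * ?O)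
     - const q * (word (u @ [GC]) * cen q GC * ?O)"
    unfolding power_Suc
    by (subst omega_def) (simp add: ring_distribs mult.assoc const_left_commute split)
  then have "word u * omega q ^ Suc l - const q * (const c * word ?s)
     = const q * (word (u @ [GA, GB, GC]) * ?O - const c * word ?s)
     + const (q^2) * (word (u @ [GA, GA]) * ?O)
     + const (inverse q ^ 2) * (word (u @ [GB, GB]) * ?O)
     + const (q^2) * (word (u @ [GC, GC]) * ?O)
     - const q * (word (u @ [GA]) * cen q GA * ?O)
     - const (inverse q) * (word (u @ [GB]) * cen q GB * ?O)
     - const q * (word (u @ [GC]) * cen q GC * ?O)"
    by (simp only: right_diff_distrib) simp
  also have "\<dots> \<in> lower q ?n"
    by (intro lower_diff lower_add lower_const low low_cen c(2)) simp_all
  finally have "word u * omega q ^ Suc l - const (q * c) * word ?s \<in> lower q ?n"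
    by (simp add: single_mult)
  with c(1) q(1) show ?case by (metis mult_eq_0_iff)
qed

lemma sorted_omega_leading:
  fixes q :: "'a::field"
  assumes q: "q \<noteq> 0" "q ^ 4 \<noteq> 1"
  shows "\<exists>c. c \<noteq> 0 \<and> word (sorted_word i j k) * omega q ^ l
      - const c * word (sorted_word (i + l) (j + l) (k + l)) \<in> lower q (i + j + k + 3 * l)"
  using omega_leading[OF q, of "sorted_word i j k" l] by (simp add: length_sorted_word)

section \<open>Spanning modulo the ideal\<close>

inductive_set spanned :: "'a::field \<Rightarrow> 'a free_alg set" for q where
  spanned_ideal: "x \<in> ideal q \<Longrightarrow> x \<in> spanned q"
| spanned_monom: "m \<in> aw_index \<Longrightarrow> aw_monom q m \<in> spanned q"
| spanned_add: "x \<in> spanned q \<Longrightarrow> y \<in> spanned q \<Longrightarrow> x + y \<in> spanned q"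
| spanned_const: "x \<in> spanned q \<Longrightarrow> const c * x \<in> spanned q"

lemma spanned_diff: "x \<in> spanned q \<Longrightarrow> y \<in> spanned q \<Longrightarrow> x - y \<in> spanned q"
  using spanned_add[of x q "- y"] spanned_const[of y q "-1"] minus_conv_const[of y]
  by (metis add_uminus_conv_diff)

lemma cen_aw_monom:
  assumes "m \<in> aw_index"
  shows "cen q g * aw_monom q m \<in> spanned q"
proof -
  obtain i j k l r s t where m: "m = (i,j,k,l,r,s,t)" by (metis prod_cases7)
  define B where "B = word (sorted_word i j k) * omega q ^ l"
  define m' where "m' = (i,j,k,l, r + (if g = GA then 1 else 0), s + (if g = GB then 1 else 0),
    t + (if g = GC then 1 else 0))"
  \<comment> \<open>\<open>X\<close> and \<open>Y\<close> cut the monomial where the new central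
    factor belongs, so that \<open>cen_move\<close> relates both positions of it.\<close>
  define X where "X = (case g of GA \<Rightarrow> B | GB \<Rightarrow> B * cen q GA ^ r | GC \<Rightarrow> B * cen q GA ^ r * cen q GB ^ s)"
  define Y where "Y = (case g of GA \<Rightarrow> cen q GA ^ r * cen q GB ^ s * cen q GC ^ t
      | GB \<Rightarrow> cen q GB ^ s * cen q GC ^ t | GC \<Rightarrow> cen q GC ^ t)"
  have "aw_monom q m = X * Y" "aw_monom q m' = X * cen q g * Y"
    by (cases g; simp add: m m'_def aw_monom_def X_def Y_def B_def mult.assoc)+
  then have "aw_monom q m' - cen q g * aw_monom q m \<in> ideal q"
    by (simp add: cen_move)
  moreover have "m' \<in> aw_index" using assms by (simp add: m m'_def aw_index_def)
  ultimately show ?thesis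
    using spanned_diff[of "aw_monom q m'" q "aw_monom q m' - cen q g * aw_monom q m"]
    by (simp add: spanned_monom spanned_ideal)
qed

lemma spanned_cen: "x \<in> spanned q \<Longrightarrow> cen q g * x \<in> spanned q"
proof (induction rule: spanned.induct)
  case (spanned_ideal x)
  then show ?case by (simp add: spanned.spanned_ideal ideal_mult_left)
qed (simp_all add: cen_aw_monom ring_distribs spanned.spanned_add const_left_commute spanned.spanned_const)

lemma lower_spanned:
  assumes "x \<in> lower q n" "\<And>w. length w < n \<Longrightarrow> word w \<in> spanned q"
  shows "x \<in> spanned q"
  using assms(1)
  by (induction rule: lower.induct) (simp_all add: assms(2) spanned.intros spanned_cen)

lemma word_spanned:
  fixes q :: "'a::field"
  assumes q: "q \<noteq> 0" "q ^ 4 \<noteq> 1"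
  shows "word w \<in> spanned q"
proof (induction w rule: length_induct)
  case (1 w)
  define i j k where "i = count_list w GA" and "j = count_list w GB" and "k = count_list w GC"
  \<comment> \<open>Subtracting the minimum makes one exponent zero, so the index is admissible,
    while the factor \<Omega>^l restores the leading word with exponents \<open>i\<close>,
    \<open>j\<close>, \<open>k\<close>.\<close>
  define l where "l = min i (min j k)"
  define n where "n = length w"
  have low: "x \<in> spanned q" if "x \<in> lower q n" for x
    using lower_spanned[OF that] 1 by (simp add: n_def)
  have n: "n = i + j + k"
    using length_sort_word[of w] by (simp add: sort_word_def length_sorted_word n_def i_def j_def k_def)
  have l: "l \<le> i" "l \<le> j" "l \<le> k" "(i - l) * (j - l) * (k - l) = 0" by (auto simp: l_def)
  obtain c where c: "c \<noteq> 0" "word w - const c * word (sorted_word i j k) \<in> lower q n"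
    using word_leading[OF q, of w] by (auto simp: n_def i_def j_def k_def sort_word_def)
  have n': "i - l + (j - l) + (k - l) + 3 * l = n" using l(1-3) by (simp add: n)
  obtain c' where c': "c' \<noteq> 0" "word (sorted_word (i - l) (j - l) (k - l)) * omega q ^ l
      - const c' * word (sorted_word i j k) \<in> lower q n"
    using sorted_omega_leading[OF q, of "i - l" "j - l" "k - l" l] l(1-3) unfolding n' by auto
  let ?s = "word (sorted_word i j k) :: 'a free_alg"
  let ?m = "word (sorted_word (i - l) (j - l) (k - l)) * omega q ^ l"
  have "?m = aw_monom q (i - l, j - l, k - l, l, 0, 0, 0)" by (simp add: aw_monom_def)
  then have "?m \<in> spanned q" using l by (simp only:) (rule spanned_monom, simp add: aw_index_def)
  from spanned_diff[OF this low[OF c'(2)]] have "const c' * ?s \<in> spanned q" by simp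
  from spanned_const[OF this, of "c / c'"] have "const c * ?s \<in> spanned q"
    using c' by (simp add: single_mult flip: mult.assoc)
  from spanned_add[OF low[OF c(2)] this] show ?case by simp
qed

lemma all_spanned:
  fixes q :: "'a::field"
  assumes "q \<noteq> 0" "q ^ 4 \<noteq> 1"
  shows "x \<in> spanned q"
proof (induction x rule: free_alg_induct)
  case (single w c)
  show ?case by (subst single_eq_const) (intro spanned_const word_spanned assms)
qed (rule spanned_add)

lemma spanned_combination:
  assumes "x \<in> spanned q"
  shows "\<exists>S c. finite S \<and> S \<subseteq> aw_index \<and> x - (\<Sum>m\<in>S. const (c m) * aw_monom q m) \<in> ideal q"
  using assms
proof (induction rule: spanned.induct)
  case (spanned_ideal x)
  then show ?case by (intro exI[of _ "{}"]) simp
next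
  case (spanned_monom m)
  then show ?case
    by (intro exI[of _ "{m}"] exI[of _ "\<lambda>_. 1"]) (simp add: ideal_0 flip: one_free_alg)
next
  case (spanned_add x y)
  then obtain S c T d where S: "finite S" "S \<subseteq> aw_index"
      "x - (\<Sum>m\<in>S. const (c m) * aw_monom q m) \<in> ideal q"
    and T: "finite T" "T \<subseteq> aw_index" "y - (\<Sum>m\<in>T. const (d m) * aw_monom q m) \<in> ideal q"
    by blast
  \<comment> \<open>Both families are extended by zero to the common index set
    \<open>S \<union> T\<close>.\<close>
  define c' d' where "c' m = (if m \<in> S then c m else 0)" and "d' m = (if m \<in> T then d m else 0)" for m
  have "(\<Sum>m\<in>S. const (c m) * aw_monom q m) = (\<Sum>m\<in>S \<union> T. const (c' m) * aw_monom q m)"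
    by (rule sum.mono_neutral_cong_left) (use S T in \<open>auto simp: c'_def\<close>)
  moreover have "(\<Sum>m\<in>T. const (d m) * aw_monom q m) = (\<Sum>m\<in>S \<union> T. const (d' m) * aw_monom q m)"
    by (rule sum.mono_neutral_cong_left) (use S T in \<open>auto simp: d'_def\<close>)
  ultimately have "x + y - (\<Sum>m\<in>S \<union> T. const (c' m + d' m) * aw_monom q m) \<in> ideal q"
    using ideal_add[OF S(3) T(3)] by (simp add: single_add distrib_right sum.distrib algebra_simps)
  with S T show ?case
    by (intro exI[of _ "S \<union> T"] exI[of _ "\<lambda>m. c' m + d' m"]) simp
next
  case (spanned_const x d)
  then obtain S c where S: "finite S" "S \<subseteq> aw_index"
      "x - (\<Sum>m\<in>S. const (c m) * aw_monom q m) \<in> ideal q"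
    by blast
  have "const d * x - (\<Sum>m\<in>S. const (d * c m) * aw_monom q m) \<in> ideal q"
    using ideal_const[OF S(3), of d]
    by (simp add: right_diff_distrib sum_distrib_left single_mult flip: mult.assoc)
  with S show ?case by (intro exI[of _ S] exI[of _ "\<lambda>m. d * c m"]) simp
qed

section \<open>Linear independence\<close>

text \<open>The ring \<open>F[\<alpha>,\<beta>,\<gamma>]\<close> is an iterated polynomial ring, with \<open>\<alpha>\<close> the innermost variable.\<close>

definition const3 :: "'a::field \<Rightarrow> 'a poly poly poly" where
  "const3 c = [:[:[:c:]:]:]"

definition var3 :: "gen \<Rightarrow> 'a::field poly poly poly" where
  "var3 g = (case g of GA \<Rightarrow> [:[:[:0, 1:]:]:] | GB \<Rightarrow> [:[:0, 1:]:] | GC \<Rightarrow> [:0, 1:])"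

lemma const3_0 [simp]: "const3 0 = 0" and const3_1 [simp]: "const3 1 = 1"
  by (simp_all add: const3_def one_pCons)

lemma const3_add: "const3 (c + d) = const3 c + const3 d"
  and const3_mult: "const3 (c * d) = const3 c * const3 d"
  by (simp_all add: const3_def)

lemma const3_var3_eq_monom:
  "const3 c * (var3 GA ^ r * (var3 GB ^ s * var3 GC ^ t)) = monom (monom (monom c r) s) t"
proof -
  have X: "[:0, 1:] ^ n = monom (1::'b::comm_ring_1) n" for n
    by (simp add: monom_altdef)
  have C: "[:p:] ^ n = [:p ^ n:]" for p :: "'b::comm_ring_1" and n
    by (induction n) (simp_all add: one_pCons)
  show ?thesis
    by (simp add: const3_def var3_def X C smult_monom)
qed

text \<open>\<open>swap3\<close>, \<open>gen3\<close> and \<open>cen3\<close> come from solving the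
  definition of \<alpha> for \<open>CB = q^2 BC + q (q^2 - q^-2) A - q (q - q^-1) \<alpha>\<close>;
  the other two rules use the same constants.\<close>

definition swap3 :: "'a::field \<Rightarrow> 'a poly poly poly" where
  "swap3 q = const3 (q^2)"

definition gen3 :: "'a::field \<Rightarrow> 'a poly poly poly" where
  "gen3 q = const3 (q * (q^2 - inverse q ^ 2))"

definition cen3 :: "'a::field \<Rightarrow> gen \<Rightarrow> 'a poly poly poly" where
  "cen3 q g = const3 (q * (q - inverse q)) * var3 g"

lemma irreducible_sorted_word: "\<not> reducible (sorted_word i j k)"
proof
  assume "reducible (sorted_word i j k)"
  then obtain u g h v where w: "sorted_word i j k = u @ g # h # v" and r: "gen_rank h < gen_rank g"
    by (auto simp: reducible_def is_redex_def)
  have "sorted (map gen_rank (sorted_word i j k))"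
    by (auto simp: sorted_word_def sorted_append)
  with r show False by (simp add: w sorted_append)
qed

text \<open>As \<open>i * j * k = 0\<close>, the least of \<open>i + l\<close>,
  \<open>j + l\<close>, \<open>k + l\<close> is \<open>l\<close>, so the sums determine
  everything.\<close>

lemma aw_index_inj:
  fixes i j k l i' j' k' l' :: nat
  assumes "i * j * k = 0" "i' * j' * k' = 0"
    "i + l = i' + l'" "j + l = j' + l'" "k + l = k' + l'"
  shows "i = i' \<and> j = j' \<and> k = k' \<and> l = l'"
  using assms by auto

lemma sorted_word_inj: "sorted_word i j k = sorted_word i' j' k' \<longleftrightarrow> i = i' \<and> j = j' \<and> k = k'"
  by (metis count_sorted_word)

definition top_degree :: "idx7 \<Rightarrow> nat" where
  "top_degree = (\<lambda>(i,j,k,l,r,s,t). i + j + k + 3 * l)"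

locale aw_param =
  fixes q :: "'a::field"
  assumes q: "q \<noteq> 0" "q ^ 4 \<noteq> 1"

sublocale aw_param \<subseteq> aw_rewriting "swap3 q" "swap3 (inverse q)" "gen3 q"
    "cen3 q GA" "cen3 q GB" "cen3 q GC"
proof
  have "q ^ 2 * inverse q ^ 2 = 1" using q by (simp add: field_simps)
  then show "swap3 q * swap3 (inverse q) = 1"
    by (simp add: swap3_def flip: const3_mult)
qed

context aw_param
begin

section \<open>The linear extension of the normal form\<close>

definition nf_lin :: "'a free_alg \<Rightarrow> gen list \<Rightarrow> 'a poly poly poly" where
  "nf_lin x s = (\<Sum>w\<in>Poly_Mapping.keys x. const3 (lk x w) * nf w s)"

lemma nf_lin_superset:
  "finite T \<Longrightarrow> Poly_Mapping.keys x \<subseteq> T \<Longrightarrow> nf_lin x s = (\<Sum>w\<in>T. const3 (lk x w) * nf w s)"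
  unfolding nf_lin_def by (rule sum.mono_neutral_left) (auto simp: in_keys_iff)

lemma nf_lin_single: "nf_lin (Poly_Mapping.single w c) s = const3 c * nf w s"
  by (subst nf_lin_superset[of "{w}"]) auto

lemma nf_lin_add: "nf_lin (x + y) s = nf_lin x s + nf_lin y s"
proof -
  let ?T = "Poly_Mapping.keys x \<union> Poly_Mapping.keys y"
  have "nf_lin x s = (\<Sum>w\<in>?T. const3 (lk x w) * nf w s)"
    "nf_lin y s = (\<Sum>w\<in>?T. const3 (lk y w) * nf w s)"
    "nf_lin (x + y) s = (\<Sum>w\<in>?T. const3 (lk (x + y) w) * nf w s)"
    by (rule nf_lin_superset; use keys_add[of x y] in auto)+
  then show ?thesis by (simp add: lookup_add const3_add distrib_right sum.distrib)
qed

lemma nf_lin_const: "nf_lin (const c * x) s = const3 c * nf_lin x s"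
  by (induction x rule: free_alg_induct)
    (simp_all add: single_mult nf_lin_single nf_lin_add ring_distribs mult.assoc const3_mult)

lemma nf_lin_diff: "nf_lin (x - y) s = nf_lin x s - nf_lin y s"
  using nf_lin_add[of "x - y" y s] by simp

lemma nf_lin_0: "nf_lin 0 s = 0"
  by (simp add: nf_lin_def)

lemma nf_lin_sum: "nf_lin (\<Sum>m\<in>S. F m) s = (\<Sum>m\<in>S. nf_lin (F m) s)"
  by (induction S rule: infinite_finite_induct) (simp_all add: nf_lin_0 nf_lin_add)

text \<open>One of the two quadratic words of \<open>cen q g\<close> is a descent. Rewriting it
  cancels the other quadratic word and the linear term and leaves the variable.\<close>

lemma nf_lin_cen_words: "nf_lin (word u * cen q g * word v) s = var3 g * nf (u @ v) s"
proof -
  define e d f where "e = q + inverse q" and "d = q^2 - inverse q ^ 2" and "f = q - inverse q"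
  have nz: "e \<noteq> 0" "d \<noteq> 0" "f \<noteq> 0" "d = e * f"
    using q_conds[OF q] by (simp_all add: e_def d_def f_def)
  define E K K' where "E = const3 e" and "K = const3 (e * (inverse d * q))"
    and "K' = const3 (e * (inverse d * inverse q))"
  \<comment> \<open>The first three identities give the cancellations; \<open>eq1\<close>, through
    \<open>d = e * f\<close>, makes the coefficient of the variable 1.\<close>
  have eqs: "e * (inverse d * inverse q) * q^2 = e * (inverse d * q)"
    "e * (inverse d * q) * inverse q ^ 2 = e * (inverse d * inverse q)"
    "e * (inverse d * inverse q) * (q * d) = e"
    using nz(1,2) q by (simp_all add: field_simps power2_eq_square)
  have eq1: "e * (inverse d * inverse q) * (q * f) = 1"
    using nz q by (simp add: nz(4) field_simps)
  have "K' * swap3 q = K" "K * swap3 (inverse q) = K'" "K' * gen3 q = E"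
      "K' * const3 (q * f) = 1"
    by (simp_all only: K_def K'_def E_def swap3_def gen3_def const3_mult[symmetric]
        d_def[symmetric] eqs eq1 const3_1)
  then have K: "K' * (swap3 q * p) = K * p" "K * (swap3 (inverse q) * p) = K' * p"
      "K' * (gen3 q * p) = E * p" "K' * (cen3 q g * p) = var3 g * p" for p g
    by (simp_all add: cen3_def flip: mult.assoc f_def)
  have "nf_lin (word u * cen q g * word v) s = E * nf (u @ g # v) s
     + K * nf (u @ next_gen g # next_gen (next_gen g) # v) s
     - K' * nf (u @ next_gen (next_gen g) # next_gen g # v) s"
    unfolding cen_expand e_def[symmetric] d_def[symmetric]
    by (simp add: ring_distribs single_mult nf_lin_add nf_lin_diff nf_lin_single E_def K_def K'_def)
  also have "\<dots> = var3 g * nf (u @ v) s"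
    by (cases g) (simp_all add: nf_BA nf_CB nf_CA ring_distribs K)
  finally show ?thesis .
qed

lemma nf_lin_cen: "nf_lin (x * cen q g * y) s = var3 g * nf_lin (x * y) s"
proof (induction x rule: free_alg_induct)
  case (single u c)
  show ?case
  proof (induction y rule: free_alg_induct)
    case (single v d)
    have "Poly_Mapping.single u c * cen q g * Poly_Mapping.single v d
        = const c * (const d * (word u * cen q g * word v))"
      by (simp only: single_eq_const[of u c] single_eq_const[of v d] mult.assoc
          const_left_commute[of "word u" d] const_left_commute[of "cen q g" d])
    then show ?case
      by (simp only: nf_lin_const nf_lin_cen_words single_mult nf_lin_single)
        (simp add: const3_mult mult_ac)
  qed (simp add: distrib_left nf_lin_add)
qed (simp add: distrib_right distrib_left nf_lin_add)

lemma nf_lin_cen_power: "nf_lin (x * (cen q g ^ n * y)) s = var3 g ^ n * nf_lin (x * y) s"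
proof (induction n arbitrary: x)
  case (Suc n)
  have "nf_lin (x * (cen q g ^ Suc n * y)) s = nf_lin (x * cen q g * (cen q g ^ n * y)) s"
    by (simp add: mult.assoc)
  also have "\<dots> = var3 g * nf_lin (x * (cen q g ^ n * y)) s"
    by (rule nf_lin_cen)
  finally show ?case by (simp add: Suc mult.assoc)
qed simp

text \<open>The outer words \<open>u\<close> and \<open>v\<close> carry the induction through the
  rule \<open>mult\<close>. The witness \<open>x\<close> is needed because members of
  \<open>aw_ideal\<close> are plain functions, whereas \<open>nf_lin\<close> takes ring
  elements.\<close>

lemma nf_lin_aw_ideal:
  assumes "f \<in> aw_ideal q"
  shows "\<exists>x. lk x = f \<and> (\<forall>u v s. nf_lin (word u * x * word v) s = 0)"
  using assms
proof (induction rule: aw_ideal.induct)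
  case (rel r)
  then obtain f h where r: "r = fa_comm f (fa_gen h)" and f: "f \<in> {aw_xA q, aw_xB q, aw_xC q}"
    by (auto simp: aw_relators_def)
  define e where "e = q + inverse q"
  have e: "e \<noteq> 0" using q_conds[OF q] by (simp add: e_def)
  obtain g where "lk (cen q g) = fa_smult e f"
    using f lookup_cen[of q] unfolding aw_alpha_def aw_beta_def aw_gamma_def e_def by blast
  then have X: "lk (const (inverse e) * cen q g) = f"
    using e by (simp add: lookup_const_mult fa_smult_def fun_eq_iff)
  \<comment> \<open>\<alpha>, \<beta>, \<gamma> are \<open>e\<close> times the elements in the
    relators, so the commutator is divided by \<open>e\<close>.\<close>
  let ?x = "const (inverse e) * (cen q g * word [h] - word [h] * cen q g)"
  have "?x = (const (inverse e) * cen q g) * word [h] - word [h] * (const (inverse e) * cen q g)"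
    by (simp add: right_diff_distrib mult.assoc const_left_commute)
  then have "lk ?x = r"
    by (simp only: lookup_diff_fa X lookup_mult_fa[of _ "word [h]"] lookup_mult_fa[of "word [h]"]
        r fa_comm_def fa_gen_def lookup_word)
  moreover have "nf_lin (word u * ?x * word v) s = 0" for u v s
  proof -
    have "word u * ?x * word v = const (inverse e) *
        (word u * cen q g * (word [h] * word v) - (word u * word [h]) * cen q g * word v)"
      by (simp add: right_diff_distrib left_diff_distrib mult.assoc const_left_commute)
    then show ?thesis
      by (simp only: nf_lin_const nf_lin_diff nf_lin_cen) (simp add: mult.assoc)
  qed
  ultimately show ?case by blast
next
  case zero
  show ?case by (rule exI[of _ 0]) (simp add: lookup_0_fa nf_lin_0)
next
  case (add f g)
  then obtain x y where "lk x = f" "\<And>u v s. nf_lin (word u * x * word v) s = 0"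
    "lk y = g" "\<And>u v s. nf_lin (word u * y * word v) s = 0" by blast
  then show ?case
    by (intro exI[of _ "x + y"]) (simp add: lookup_add_fa ring_distribs nf_lin_add)
next
  case (smult f c)
  then obtain x where "lk x = f" "\<And>u v s. nf_lin (word u * x * word v) s = 0" by blast
  then show ?case
    by (intro exI[of _ "const c * x"])
      (simp add: lookup_const_mult const_left_commute mult.assoc nf_lin_const)
next
  case (mult f u' v')
  then obtain x where x: "lk x = f" "\<And>u v s. nf_lin (word u * x * word v) s = 0" by blast
  have "word u * (word u' * (x * word v')) * word v = word (u @ u') * x * word (v' @ v)" for u v
  proof -
    have "word (u @ u') = word u * (word u' :: 'a free_alg)" "word (v' @ v) = word v' * (word v :: 'a free_alg)"
      by (simp_all add: single_mult)
    then show ?thesis by (simp only: mult.assoc)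
  qed
  with x show ?case
    by (intro exI[of _ "word u' * (x * word v')"]) (simp add: lookup_mult_fa lookup_word)
qed

lemma nf_lin_ideal:
  assumes "x \<in> ideal q"
  shows "nf_lin x s = 0"
proof -
  obtain y where "lk y = lk x" "nf_lin (word [] * y * word []) s = 0"
    using nf_lin_aw_ideal assms unfolding ideal_def by blast
  then show ?thesis by (simp flip: one_free_alg)
qed

lemma nf_lin_lower: "x \<in> lower q n \<Longrightarrow> n \<le> length s \<Longrightarrow> nf_lin x s = 0"
proof (induction rule: lower.induct)
  case (lower_cen x g)
  then show ?case using nf_lin_cen[of 1 g x s] by simp
qed (simp_all add: nf_lin_ideal nf_lin_single nf_eq_0_if_longer nf_lin_add nf_lin_const)

text \<open>The lower-degree error of \<open>sorted_omega_leading\<close> vanishes at words this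
  long, and the central powers turn into powers of the variables.\<close>

lemma nf_lin_aw_monom_leading:
  "\<exists>c. c \<noteq> 0 \<and> (\<forall>r s t w. i + j + k + 3 * l \<le> length w \<longrightarrow>
     nf_lin (aw_monom q (i,j,k,l,r,s,t)) w
       = (if w = sorted_word (i + l) (j + l) (k + l) then monom (monom (monom c r) s) t else 0))"
proof -
  let ?B = "word (sorted_word i j k) * omega q ^ l" and ?w = "sorted_word (i + l) (j + l) (k + l)"
  obtain c where c: "c \<noteq> 0" "?B - const c * word ?w \<in> lower q (i + j + k + 3 * l)"
    using sorted_omega_leading[OF q] by blast
  have B: "nf_lin ?B w = (if w = ?w then const3 c else 0)" if "i + j + k + 3 * l \<le> length w" for w
    using nf_lin_lower[OF c(2) that]
    by (simp add: nf_lin_diff nf_lin_const nf_lin_single nf_irreducible irreducible_sorted_word split: if_splits)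
  have "nf_lin (aw_monom q (i,j,k,l,r,s,t)) w
      = var3 GA ^ r * (var3 GB ^ s * var3 GC ^ t) * nf_lin ?B w" for r s t w
    using nf_lin_cen_power[of "?B * (cen q GA ^ r * cen q GB ^ s)" GC t 1 w]
      nf_lin_cen_power[of "?B * cen q GA ^ r" GB s 1 w] nf_lin_cen_power[of ?B GA r 1 w]
    by (simp add: aw_monom_def mult_ac)
  then show ?thesis
    using c(1) B by (intro exI[of _ c]) (simp add: const3_var3_eq_monom[symmetric] mult_ac)
qed

lemma aw_monom_independent:
  assumes S: "finite S" "S \<subseteq> aw_index"
    and mem: "(\<Sum>m\<in>S. const (c m) * aw_monom q m) \<in> ideal q" and "m \<in> S"
  shows "c m = 0"
proof (rule ccontr)
  assume "c m \<noteq> 0"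
  define T where "T = {m \<in> S. c m \<noteq> 0}"
  have "m \<in> T" using \<open>m \<in> S\<close> \<open>c m \<noteq> 0\<close> by (simp add: T_def)
  then have "finite T" "T \<noteq> {}" using S(1) by (simp add: T_def, blast)
  then have "Max (top_degree ` T) \<in> top_degree ` T" by simp
  \<comment> \<open>With \<open>m0\<close> of maximal degree, every index in \<open>T\<close>
    satisfies the length condition of the leading-term lemma at the leading word of
    \<open>m0\<close>.\<close>
  then obtain m0 where "m0 \<in> T" "top_degree m0 = Max (top_degree ` T)" by fastforce
  with \<open>finite T\<close> have m0: "m0 \<in> T" "\<And>m. m \<in> T \<Longrightarrow> top_degree m \<le> top_degree m0"
    by simp_all
  obtain i j k l r s t where m0_eq: "m0 = (i,j,k,l,r,s,t)" by (metis prod_cases7)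
  define w where "w = sorted_word (i + l) (j + l) (k + l)"
  have len: "length w = top_degree m0"
    by (simp add: w_def length_sorted_word m0_eq top_degree_def)
  \<comment> \<open>\<open>co\<close> reads off the coefficient of the central monomial of
    \<open>m0\<close>; \<gamma> is the outermost variable, hence the order \<open>t\<close>,
    \<open>s\<close>, \<open>r\<close>.\<close>
  define co :: "'a poly poly poly \<Rightarrow> 'a" where "co p = coeff (coeff (coeff p t) s) r" for p
  have co_sum: "co (sum f A) = (\<Sum>x\<in>A. co (f x))" for f and A :: "idx7 set"
    by (simp add: co_def coeff_sum)
  have co_const: "co (const3 d * p) = d * co p" for d p
    by (simp add: co_def const3_def)
  have zero: "c m * co (nf_lin (aw_monom q m) w) = 0" if m: "m \<in> S" "m \<noteq> m0" for m
  proof (cases "c m = 0")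
    case False
    with m have "m \<in> T" by (simp add: T_def)
    obtain i' j' k' l' r' s' t' where m_eq: "m = (i',j',k',l',r',s',t')" by (metis prod_cases7)
    have "i' + j' + k' + 3 * l' \<le> length w"
      using m0(2)[OF \<open>m \<in> T\<close>] unfolding len by (simp add: m_eq top_degree_def)
    then obtain d where d: "nf_lin (aw_monom q m) w = (if w = sorted_word (i' + l') (j' + l') (k' + l')
        then monom (monom (monom d r') s') t' else 0)"
      using nf_lin_aw_monom_leading[of i' j' k' l'] unfolding m_eq by blast
    show ?thesis
    proof (cases "w = sorted_word (i' + l') (j' + l') (k' + l')")
      \<comment> \<open>Equal leading words force equal \<open>i\<close>, \<open>j\<close>,
        \<open>k\<close>, \<open>l\<close>, so the two indices differ in the central exponents and
        \<open>co\<close> gives zero.\<close>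
      case True
      have "m \<in> aw_index" "m0 \<in> aw_index" using m m0(1) S by (auto simp: T_def)
      then have "i * j * k = 0" "i' * j' * k' = 0" by (simp_all add: m_eq m0_eq aw_index_def)
      from aw_index_inj[OF this, of l l'] True
      have "i = i' \<and> j = j' \<and> k = k' \<and> l = l'"
        unfolding w_def sorted_word_inj by blast
      with m(2) have "\<not> (r = r' \<and> s = s' \<and> t = t')" by (auto simp: m_eq m0_eq)
      with d True show ?thesis by (auto simp: co_def)
    qed (simp add: d co_def)
  qed simp
  obtain d where d: "d \<noteq> 0" "nf_lin (aw_monom q m0) w = monom (monom (monom d r) s) t"
    using nf_lin_aw_monom_leading[of i j k l] len unfolding m0_eq w_def top_degree_def by auto
  have "0 = co (nf_lin (\<Sum>m\<in>S. const (c m) * aw_monom q m) w)"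
    using nf_lin_ideal[OF mem] by (simp add: co_def)
  also have "\<dots> = (\<Sum>m\<in>S. c m * co (nf_lin (aw_monom q m) w))"
    by (simp add: nf_lin_sum nf_lin_const co_sum co_const)
  also have "\<dots> = (\<Sum>m\<in>{m0}. c m * co (nf_lin (aw_monom q m) w))"
    by (rule sum.mono_neutral_right) (use S m0(1) zero in \<open>auto simp: T_def\<close>)
  also have "\<dots> = c m0 * d" by (simp add: d co_def)
  finally show False using m0(1) d(1) by (simp add: T_def)
qed

end

section \<open>The basis property, carried back to plain functions\<close>

theorem theorem7p5:
  fixes q :: "'a::field"
  assumes "q \<noteq> 0" and "q ^ 4 \<noteq> 1"
  shows "(\<forall>f. fa_finsupp f \<longrightarrow>
            (\<exists>S c. finite S \<and> S \<subseteq> aw_index \<and>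
               fa_diff f (fa_sum S (\<lambda>x. fa_smult (c x) (aw_mono q x))) \<in> aw_ideal q))
       \<and> (\<forall>S c. finite S \<longrightarrow> S \<subseteq> aw_index \<longrightarrow>
            fa_sum S (\<lambda>x. fa_smult (c x) (aw_mono q x)) \<in> aw_ideal q \<longrightarrow>
            (\<forall>x\<in>S. c x = 0))"
proof -
  interpret aw_param q using assms by unfold_locales
  have comb: "lk (\<Sum>m\<in>S. const (c m) * aw_monom q m) = fa_sum S (\<lambda>x. fa_smult (c x) (aw_mono q x))"
    for S and c :: "idx7 \<Rightarrow> 'a"
    by (simp add: lookup_sum_fa lookup_const_mult lookup_aw_monom)
  show ?thesis
  proof (intro conjI allI impI)
    fix f :: "'a fa"
    assume "fa_finsupp f"
    \<comment> \<open>Finite support ensures that \<open>Abs_poly_mapping\<close> really represents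
      \<open>f\<close>.\<close>
    then have f: "lk (Abs_poly_mapping f) = f" by (simp add: fa_finsupp_def)
    obtain S c where "finite S" "S \<subseteq> aw_index"
      "Abs_poly_mapping f - (\<Sum>m\<in>S. const (c m) * aw_monom q m) \<in> ideal q"
      using spanned_combination[OF all_spanned[OF assms]] by blast
    moreover from this(3) have "fa_diff f (fa_sum S (\<lambda>x. fa_smult (c x) (aw_mono q x))) \<in> aw_ideal q"
      by (simp add: ideal_def lookup_diff_fa f comb)
    ultimately show "\<exists>S c. finite S \<and> S \<subseteq> aw_index \<and>
        fa_diff f (fa_sum S (\<lambda>x. fa_smult (c x) (aw_mono q x))) \<in> aw_ideal q"
      by blast
  next
    fix S and c :: "idx7 \<Rightarrow> 'a"
    assume S: "finite S" "S \<subseteq> aw_index"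
      and "fa_sum S (\<lambda>x. fa_smult (c x) (aw_mono q x)) \<in> aw_ideal q"
    then have "(\<Sum>m\<in>S. const (c m) * aw_monom q m) \<in> ideal q"
      unfolding ideal_def comb[symmetric] by blast
    from aw_monom_independent[OF S this] show "\<forall>x\<in>S. c x = 0" by blast
  qed
qed

end
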